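(* Let $k$ be a nonnegative integer and let $G$ be a connected graph with maximum degree $\Delta(G)\geq k+2$. Then \[ Z_k(G)\leq \gamma_{P,k}(G)\,(\Delta(G)+1-k), \quad\text{equivalently}\quad \left\lceil\frac{Z_k(G)}{\Delta(G)+1-k}\right\rceil\le \gamma_{P,k}(G).\] Moreover, this lower bound for $\gamma_{P,k}(G)$ is tight: there exist connected graphs $G$ with $\Delta(G)\ge k+2$ for which $\left\lceil\frac{Z_k(G)}{\Delta(G)+1-k}\right\rceil= \gamma_{P,k}(G)$.
   Context: Graphs are finite, simple and undirected. $N(v)$ is the open neighborhood, $N[S]=\bigcup_{v\in S}(N(v)\cup\{v\})$. For a graph $G=(V,E)$, a nonnegative integer $k$ and $T\subseteq V$, define $\mathscr F^0_{G,k}(T)=T$ and $\mathscr F^{i+1}_{G,k}(T)=\mathscr F^i_{G,k}(T)\cup\bigcup\{N(v): v\in \mathscr F^i_{G,k}(T),\ 1\le |N(v)\setminus \mathscr F^i_{G,k}(T)|\le k\}$. $T$ is a $k$-forcing set of $G$ if $\mathscr F^t_{G,k}(T)=V$ for some $t$; $Z_k(G)$ is the minimum size of a $k$-forcing set. For $S\subseteq V$ define $\mathscr P^0_{G,k}(S)=N[S]$ and $\mathscr P^{i+1}_{G,k}(S)=\mathscr P^i_{G,k}(S)\cup\bigcup\{N(v): v\in \mathscr P^i_{G,k}(S),\ 1\le |N(v)\setminus \mathscr P^i_{G,k}(S)|\le k\}$. $S$ is a $k$-power dominating set of $G$ if $\mathscr P^\ell_{G,k}(S)=V$ for some $\ell$;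 $\gamma_{P,k}(G)$ is the minimum size of a $k$-power dominating set. *)

theory Defs
  imports Complex_Main "Graph_Theory.Graph_Theory"
begin

text \<open>
  A finite simple undirected graph is a \<^locale>\<open>pair_graph\<close>: finite vertex set, arcs are pairs of
  vertices, symmetric and without loops.  An undirected edge is the pair of its two opposite arcs,
  so the out-degree of a vertex is its degree.
\<close>

definition nbrs :: "'a pair_pre_digraph \<Rightarrow> 'a \<Rightarrow> 'a set" where
  "nbrs G v = {u. v \<rightarrow>\<^bsub>G\<^esub> u}"

definition closed_nbrs :: "'a pair_pre_digraph \<Rightarrow> 'a set \<Rightarrow> 'a set" where
  "closed_nbrs G S = (\<Union>v\<in>S. nbrs G v \<union> {v})"

definition max_degree :: "'a pair_pre_digraph \<Rightarrow> nat" where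
  "max_degree G = Max (out_degree G ` pverts G)"

definition force_step :: "'a pair_pre_digraph \<Rightarrow> nat \<Rightarrow> 'a set \<Rightarrow> 'a set" where
  "force_step G k A =
     A \<union> \<Union> {nbrs G v | v. v \<in> A \<and> 1 \<le> card (nbrs G v - A) \<and> card (nbrs G v - A) \<le> k}"

primrec forced :: "'a pair_pre_digraph \<Rightarrow> nat \<Rightarrow> 'a set \<Rightarrow> nat \<Rightarrow> 'a set" where
  "forced G k T 0 = T"
| "forced G k T (Suc i) = force_step G k (forced G k T i)"

definition k_forcing_set :: "'a pair_pre_digraph \<Rightarrow> nat \<Rightarrow> 'a set \<Rightarrow> bool" where
  "k_forcing_set G k T \<longleftrightarrow> T \<subseteq> pverts G \<and> (\<exists>t. forced G k T t = pverts G)"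

definition k_forcing_number :: "nat \<Rightarrow> 'a pair_pre_digraph \<Rightarrow> nat" where
  "k_forcing_number k G = Min (card ` {T. k_forcing_set G k T})"

primrec power_dominated :: "'a pair_pre_digraph \<Rightarrow> nat \<Rightarrow> 'a set \<Rightarrow> nat \<Rightarrow> 'a set" where
  "power_dominated G k S 0 = closed_nbrs G S"
| "power_dominated G k S (Suc i) = force_step G k (power_dominated G k S i)"

definition k_power_dominating_set :: "'a pair_pre_digraph \<Rightarrow> nat \<Rightarrow> 'a set \<Rightarrow> bool" where
  "k_power_dominating_set G k S \<longleftrightarrow>
     S \<subseteq> pverts G \<and> (\<exists>l. power_dominated G k S l = pverts G)"

text \<open>
  For a finite graph both minima range over nonempty finite sets, since the whole vertex set
  is always k-forcing and k-power dominating.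
\<close>

definition k_power_domination_number :: "nat \<Rightarrow> 'a pair_pre_digraph \<Rightarrow> nat" where
  "k_power_domination_number k G = Min (card ` {S. k_power_dominating_set G k S})"

end

theory Submission
  imports Defs
begin

text \<open>
  Given a \<open>k\<close>-power dominating set \<open>S\<close>, build a \<open>k\<close>-forcing set by adding to \<open>S\<close>, for each
  \<open>v \<in> S\<close>, all but \<open>k\<close> of the neighbours of \<open>v\<close>; this costs at most \<open>\<Delta> + 1 - k\<close> vertices per element
  of \<open>S\<close>.  One forcing step then covers \<open>N[S]\<close>, and as a forcing step is monotone in the set of
  coloured vertices, the forcing process stays ahead of the power domination process from there on.
  Equality holds whenever \<open>\<gamma> = 1\<close>, for instance for the complete graph on \<open>k + 3\<close> vertices.
\<close>

lemma nbrs_eq: "nbrs G v = {u. (v, u) \<in> parcs G}"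
  by (simp add: nbrs_def)

lemma force_step_superset: "A \<subseteq> force_step G k A"
  by (auto simp: force_step_def)

definition complete_pair_graph :: "nat \<Rightarrow> nat pair_pre_digraph" where
  "complete_pair_graph n =
     \<lparr>pverts = {..<n}, parcs = {(u, v). u < n \<and> v < n \<and> u \<noteq> v}\<rparr>"

context pair_fin_digraph
begin

section \<open>Neighbourhoods, degrees and monotonicity of forcing\<close>

lemma nbrs_subset: "nbrs G v \<subseteq> pverts G"
  by (auto simp: nbrs_eq dest: in_arcsD2)

lemma finite_nbrs: "finite (nbrs G v)"
  using nbrs_subset pair_finite_verts by (rule finite_subset)

lemma out_degree_eq_card_nbrs: "out_degree G v = card (nbrs G v)"
proof -
  have "out_arcs G v = Pair v ` nbrs G v"
    by (auto simp: out_arcs_def nbrs_eq)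
  then show ?thesis
    by (simp add: out_degree_def card_image inj_on_def)
qed

lemma card_nbrs_le_max_degree: "v \<in> pverts G \<Longrightarrow> card (nbrs G v) \<le> max_degree G"
  using pair_finite_verts by (auto simp: max_degree_def out_degree_eq_card_nbrs)

text \<open>The lower bound 1 in the forcing rule costs nothing: if no neighbour of \<open>v\<close>
  lies outside \<open>A\<close>, then the whole neighbourhood is already in \<open>A\<close>. Later
  arguments therefore only have to check the upper bound \<open>k\<close>.\<close>

lemma nbrs_subset_force_step:
  assumes "v \<in> A" "card (nbrs G v - A) \<le> k"
  shows "nbrs G v \<subseteq> force_step G k A"
proof (cases "nbrs G v \<subseteq> A")
  case True
  then show ?thesis using force_step_superset by (rule order_trans)
next
  case False
  then have "0 < card (nbrs G v - A)"
    using finite_nbrs by (subst card_gt_0_iff) blast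
  then have "1 \<le> card (nbrs G v - A)" by linarith
  with assms show ?thesis unfolding force_step_def by blast
qed

text \<open>Enlarging the coloured set only shrinks \<open>nbrs G v - A\<close>, so a vertex that
  forces from \<open>A\<close> still meets the upper bound in \<open>B\<close>. It may have nothing
  left to force there, and then its neighbours already lie in \<open>B\<close>.\<close>

lemma force_step_mono:
  assumes "A \<subseteq> B"
  shows "force_step G k A \<subseteq> force_step G k B"
proof -
  have "nbrs G v \<subseteq> force_step G k B" if "v \<in> A" "card (nbrs G v - A) \<le> k" for v
  proof (rule nbrs_subset_force_step)
    show "v \<in> B" using that assms by blast
    have "card (nbrs G v - B) \<le> card (nbrs G v - A)"
      using assms finite_nbrs by (intro card_mono) auto
    then show "card (nbrs G v - B) \<le> k" using that by simp
  qed
  moreover have "A \<subseteq> force_step G k B"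
    using assms force_step_superset by (rule order_trans)
  ultimately show ?thesis
    unfolding force_step_def[of G k A] by blast
qed

lemma force_step_subset_pverts: "A \<subseteq> pverts G \<Longrightarrow> force_step G k A \<subseteq> pverts G"
  using nbrs_subset by (fastforce simp: force_step_def)

lemma forced_subset_pverts: "T \<subseteq> pverts G \<Longrightarrow> forced G k T i \<subseteq> pverts G"
  by (induction i) (simp_all add: force_step_subset_pverts)

text \<open>The index is shifted by one because forcing spends its first step on covering
  \<open>closed_nbrs G S\<close>, where power domination starts. From then on both processes apply
  the same monotone step.\<close>

lemma power_dominated_subset_forced:
  assumes "closed_nbrs G S \<subseteq> force_step G k T"
  shows "power_dominated G k S i \<subseteq> forced G k T (Suc i)"
proof (induction i)
  case 0
  then show ?case using assms by simp
next
  case (Suc i)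
  then show ?case unfolding power_dominated.simps forced.simps by (rule force_step_mono)
qed

section \<open>Minimum forcing and power dominating sets\<close>

lemma k_forcing_set_pverts: "k_forcing_set G k (pverts G)"
  unfolding k_forcing_set_def by (metis forced.simps(1) order_refl)

lemma finite_k_forcing_sets: "finite {T. k_forcing_set G k T}"
  by (rule finite_subset[of _ "Pow (pverts G)"])
    (use pair_finite_verts in \<open>auto simp: k_forcing_set_def\<close>)

lemma finite_k_power_dominating_sets: "finite {S. k_power_dominating_set G k S}"
  by (rule finite_subset[of _ "Pow (pverts G)"])
    (use pair_finite_verts in \<open>auto simp: k_power_dominating_set_def\<close>)

lemma k_forcing_number_le: "k_forcing_set G k T \<Longrightarrow> k_forcing_number k G \<le> card T"
  unfolding k_forcing_number_def using finite_k_forcing_sets by (intro Min_le) auto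

lemma k_power_domination_number_le:
  "k_power_dominating_set G k S \<Longrightarrow> k_power_domination_number k G \<le> card S"
  unfolding k_power_domination_number_def
  using finite_k_power_dominating_sets by (intro Min_le) auto

text \<open>The process starts at \<open>closed_nbrs G S\<close>, so stage 0 is the witness. This
  covers both the full vertex set, which makes the minimum well defined, and a single dominating
  vertex.\<close>

lemma k_power_dominating_set_if_dominating:
  assumes "S \<subseteq> pverts G" "closed_nbrs G S = pverts G"
  shows "k_power_dominating_set G k S"
  unfolding k_power_dominating_set_def using assms by (metis power_dominated.simps(1))

lemma k_power_dominating_set_pverts: "k_power_dominating_set G k (pverts G)"
  by (rule k_power_dominating_set_if_dominating) (use nbrs_subset in \<open>auto simp: closed_nbrs_def\<close>)

lemma k_forcing_number_attained:
  obtains T where "k_forcing_set G k T" "card T = k_forcing_number k G"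
proof -
  have "k_forcing_number k G \<in> card ` {T. k_forcing_set G k T}"
    unfolding k_forcing_number_def
    using finite_k_forcing_sets k_forcing_set_pverts by (intro Min_in) auto
  then show thesis using that by auto
qed

lemma k_power_domination_number_attained:
  obtains S where "k_power_dominating_set G k S" "card S = k_power_domination_number k G"
proof -
  have "k_power_domination_number k G \<in> card ` {S. k_power_dominating_set G k S}"
    unfolding k_power_domination_number_def
    using finite_k_power_dominating_sets k_power_dominating_set_pverts by (intro Min_in) auto
  then show thesis using that by auto
qed

lemma forced_empty: "forced G k {} i = {}"
  by (induction i) (simp_all add: force_step_def)

text \<open>Only coloured vertices force, so the empty set stays empty forever and cannot fill a
  nonempty graph.\<close>

lemma k_forcing_number_pos:
  assumes "pverts G \<noteq> {}"
  shows "0 < k_forcing_number k G"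
proof -
  obtain T where T: "k_forcing_set G k T" "card T = k_forcing_number k G"
    by (rule k_forcing_number_attained)
  then have "T \<noteq> {}" "finite T"
    using assms pair_finite_verts
    by (auto simp: k_forcing_set_def forced_empty intro: finite_subset)
  then show ?thesis using T by (metis card_gt_0_iff)
qed

section \<open>The bound and its equality case\<close>

lemma k_forcing_number_le_mult_k_power_domination_number:
  assumes "k \<le> max_degree G"
  shows "k_forcing_number k G \<le> k_power_domination_number k G * (max_degree G + 1 - k)"
proof -
  obtain S where S: "k_power_dominating_set G k S" "card S = k_power_domination_number k G"
    by (rule k_power_domination_number_attained)
  then have "S \<subseteq> pverts G" by (simp add: k_power_dominating_set_def)
  \<comment> \<open>Subtraction truncates: if \<open>v\<close> has at most \<open>k\<close>
    neighbours, \<open>B v\<close> is empty and \<open>v\<close> forces all of them unaided.\<close>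
  have "\<exists>B. B \<subseteq> nbrs G v \<and> card B = card (nbrs G v) - k" for v
    by (rule obtain_subset_with_card_n[of "card (nbrs G v) - k" "nbrs G v"]) auto
  then obtain B where B: "B v \<subseteq> nbrs G v" "card (B v) = card (nbrs G v) - k" for v
    by metis
  define T where "T = (\<Union>v\<in>S. insert v (B v))"
  have "nbrs G v \<subseteq> force_step G k T" if "v \<in> S" for v
  proof (rule nbrs_subset_force_step)
    show "v \<in> T" using that by (auto simp: T_def)
    have "card (nbrs G v - T) \<le> card (nbrs G v - B v)"
      using that finite_nbrs by (intro card_mono) (auto simp: T_def)
    \<comment> \<open>For d = \<open>card (nbrs G v)\<close>, the number left over is d - (d - k),
      which is the minimum of d and \<open>k\<close>.\<close>
    also have "\<dots> \<le> k"
      using B[of v] finite_nbrs[of v] by (simp add: card_Diff_subset finite_subset)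
    finally show "card (nbrs G v - T) \<le> k" .
  qed
  moreover have "S \<subseteq> force_step G k T"
    using force_step_superset by (fastforce simp: T_def)
  ultimately have "closed_nbrs G S \<subseteq> force_step G k T"
    by (auto simp: closed_nbrs_def)
  moreover have "T \<subseteq> pverts G"
    using \<open>S \<subseteq> pverts G\<close> B(1) nbrs_subset by (fastforce simp: T_def)
  \<comment> \<open>If power domination from \<open>S\<close> is complete at stage l, forcing from
    \<open>T\<close> contains all vertices at stage l + 1, and it never leaves
    \<open>pverts G\<close>.\<close>
  ultimately have "k_forcing_set G k T"
    using S(1) power_dominated_subset_forced forced_subset_pverts
    unfolding k_forcing_set_def k_power_dominating_set_def by (metis subset_antisym)
  then have "k_forcing_number k G \<le> card T" by (rule k_forcing_number_le)
  also have "\<dots> \<le> (\<Sum>v\<in>S. card (insert v (B v)))"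
    unfolding T_def using \<open>S \<subseteq> pverts G\<close> pair_finite_verts
    by (intro card_UN_le) (rule finite_subset)
  also have "\<dots> \<le> (\<Sum>v\<in>S. max_degree G + 1 - k)"
  proof (rule sum_mono)
    fix v assume "v \<in> S"
    then have "card (nbrs G v) \<le> max_degree G"
      using \<open>S \<subseteq> pverts G\<close> card_nbrs_le_max_degree by blast
    moreover have "card (insert v (B v)) \<le> Suc (card (B v))"
      by (rule card_insert_le_m1) auto
    \<comment> \<open>The assumption \<open>k\<close> \<le> \<open>max_degree G\<close> matters for
      vertices of degree below \<open>k\<close>: they contribute 1, and the right-hand side is then
      at least 1.\<close>
    ultimately show "card (insert v (B v)) \<le> max_degree G + 1 - k"
      using B(2)[of v] assms by linarith
  qed
  finally show ?thesis using S(2) by simp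
qed

lemma ceiling_k_forcing_number_le:
  assumes "k \<le> max_degree G"
  shows "\<lceil>real (k_forcing_number k G) / real (max_degree G + 1 - k)\<rceil>
    \<le> int (k_power_domination_number k G)"
proof -
  have "real (k_forcing_number k G)
      \<le> real (k_power_domination_number k G) * real (max_degree G + 1 - k)"
    using k_forcing_number_le_mult_k_power_domination_number[OF assms]
    by (metis of_nat_le_iff of_nat_mult)
  \<comment> \<open>The divisor is positive because \<open>k\<close> \<le>
    \<open>max_degree G\<close>. It is kept as the cast of one natural number so that it matches the
    inequality above.\<close>
  then show ?thesis
    using assms by (simp add: ceiling_le_iff pos_divide_le_eq del: of_nat_diff)
qed

text \<open>Both sides are 1: a dominating vertex gives a power domination number of at most 1,
  while the quotient is positive and so has ceiling at least 1. The general bound closes the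
  chain.\<close>

lemma ceiling_k_forcing_number_eq_if_dominating_vertex:
  assumes "k \<le> max_degree G" "v \<in> pverts G" "closed_nbrs G {v} = pverts G"
  shows "\<lceil>real (k_forcing_number k G) / real (max_degree G + 1 - k)\<rceil>
    = int (k_power_domination_number k G)"
proof (rule antisym[OF ceiling_k_forcing_number_le[OF assms(1)]])
  have "k_power_dominating_set G k {v}"
    by (rule k_power_dominating_set_if_dominating) (use assms in auto)
  then have "k_power_domination_number k G \<le> 1"
    using k_power_domination_number_le by fastforce
  moreover have "0 < real (k_forcing_number k G) / real (max_degree G + 1 - k)"
  proof (rule divide_pos_pos)
    show "0 < real (k_forcing_number k G)"
      using k_forcing_number_pos[of k] assms(2) by auto
    show "0 < real (max_degree G + 1 - k)"
      using assms(1) by simp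
  qed
  then have "0 < \<lceil>real (k_forcing_number k G) / real (max_degree G + 1 - k)\<rceil>"
    by (simp only: zero_less_ceiling)
  ultimately show "int (k_power_domination_number k G)
      \<le> \<lceil>real (k_forcing_number k G) / real (max_degree G + 1 - k)\<rceil>"
    by linarith
qed

end

section \<open>Complete graphs as tight examples\<close>

lemma pverts_complete_pair_graph [simp]: "pverts (complete_pair_graph n) = {..<n}"
  by (simp add: complete_pair_graph_def)

lemma pair_graph_complete_pair_graph: "pair_graph (complete_pair_graph n)"
proof
  have "parcs (complete_pair_graph n) \<subseteq> {..<n} \<times> {..<n}"
    by (auto simp: complete_pair_graph_def)
  then show "finite (parcs (complete_pair_graph n))"
    by (rule finite_subset) simp
qed (auto simp: complete_pair_graph_def symmetric_def sym_def)

lemma nbrs_complete_pair_graph: "v < n \<Longrightarrow> nbrs (complete_pair_graph n) v = {..<n} - {v}"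
  by (auto simp: nbrs_eq complete_pair_graph_def)

lemma connected_complete_pair_graph:
  assumes "0 < n"
  shows "connected (complete_pair_graph n)"
proof -
  interpret G: pair_graph "complete_pair_graph n"
    by (rule pair_graph_complete_pair_graph)
  have "strongly_connected (complete_pair_graph n)"
  proof
    show "verts (complete_pair_graph n) \<noteq> {}"
      using assms by auto
    fix u v assume "u \<in> verts (complete_pair_graph n)" "v \<in> verts (complete_pair_graph n)"
    then show "u \<rightarrow>\<^sup>*\<^bsub>complete_pair_graph n\<^esub> v"
    proof (cases "u = v")
      case True
      then show ?thesis using \<open>v \<in> verts _\<close> by simp
    next
      case False
      then have "(u, v) \<in> parcs (complete_pair_graph n)"
        using \<open>u \<in> verts _\<close> \<open>v \<in> verts _\<close> by (simp add: complete_pair_graph_def)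
      then show ?thesis by (rule G.reachable_adjI)
    qed
  qed
  \<comment> \<open>\<open>connected\<close> means strong connectivity of the symmetric closure, so
    reachability has to be carried over to that closure.\<close>
  then show ?thesis
    using G.reachable_mk_symmetricI by (auto simp: connected_def strongly_connected_def)
qed

lemma max_degree_complete_pair_graph:
  assumes "0 < n"
  shows "max_degree (complete_pair_graph n) = n - 1"
proof -
  interpret G: pair_graph "complete_pair_graph n"
    by (rule pair_graph_complete_pair_graph)
  have "out_degree (complete_pair_graph n) ` pverts (complete_pair_graph n) = (\<lambda>_. n - 1) ` {..<n}"
    by (rule image_cong)
      (auto simp: G.out_degree_eq_card_nbrs nbrs_complete_pair_graph)
  \<comment> \<open>All degrees coincide, and since \<open>n\<close> is positive the maximum is
    taken over a singleton.\<close>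
  then show ?thesis
    using assms by (simp add: max_degree_def image_constant_conv lessThan_empty_iff)
qed

theorem theorem5p4:
  fixes k :: nat
  shows "(\<forall>G :: 'a pair_pre_digraph.
            pair_graph G \<and> connected G \<and> max_degree G \<ge> k + 2 \<longrightarrow>
              k_forcing_number k G \<le> k_power_domination_number k G * (max_degree G + 1 - k) \<and>
              \<lceil>real (k_forcing_number k G) / real (max_degree G + 1 - k)\<rceil>
                \<le> int (k_power_domination_number k G)) \<and>
         (\<exists>G :: nat pair_pre_digraph.
            pair_graph G \<and> connected G \<and> max_degree G \<ge> k + 2 \<and>
              \<lceil>real (k_forcing_number k G) / real (max_degree G + 1 - k)\<rceil>
                = int (k_power_domination_number k G))"
proof (intro conjI allI impI)
  fix G :: "'a pair_pre_digraph"
  assume G: "pair_graph G \<and> connected G \<and> max_degree G \<ge> k + 2"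
  then interpret pair_graph G by simp
  from G have "k \<le> max_degree G" by simp
  then show "k_forcing_number k G \<le> k_power_domination_number k G * (max_degree G + 1 - k)"
    and "\<lceil>real (k_forcing_number k G) / real (max_degree G + 1 - k)\<rceil>
      \<le> int (k_power_domination_number k G)"
    by (rule k_forcing_number_le_mult_k_power_domination_number, rule ceiling_k_forcing_number_le)
next
  \<comment> \<open>The complete graph on n vertices has degree n - 1, so \<open>k + 3\<close> is
    the least order that meets the degree condition.\<close>
  let ?K = "complete_pair_graph (k + 3)"
  interpret pair_graph ?K by (rule pair_graph_complete_pair_graph)
  have deg: "max_degree ?K = k + 2"
    by (simp add: max_degree_complete_pair_graph)
  have "closed_nbrs ?K {0} = pverts ?K"
    by (auto simp: closed_nbrs_def nbrs_complete_pair_graph)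
  then have "\<lceil>real (k_forcing_number k ?K) / real (max_degree ?K + 1 - k)\<rceil>
      = int (k_power_domination_number k ?K)"
    using deg
    by (intro ceiling_k_forcing_number_eq_if_dominating_vertex[of _ 0]) simp_all
  then show "\<exists>G :: nat pair_pre_digraph.
      pair_graph G \<and> connected G \<and> max_degree G \<ge> k + 2 \<and>
        \<lceil>real (k_forcing_number k G) / real (max_degree G + 1 - k)\<rceil>
          = int (k_power_domination_number k G)"
    using deg connected_complete_pair_graph[of "k + 3"] pair_graph_complete_pair_graph
    by (intro exI[of _ ?K]) simp
qed

end
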